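(* Let $B$ be a finite geometric left regular band monoid. Then the order complex of the poset $B\setminus\{1\}$ (with the $\mathcal R$-order) is homotopy equivalent to the clique complex $\mathsf{Cliq}(\Gamma(\mathscr M(B)))$ of the commutation graph of the set $\mathscr M(B)$ of maximal elements of $B\setminus\{1\}$.
   Context: A left regular band is a semigroup $B$ with $x^2=x$ and $xyx=xy$ for all $x,y$; here $B$ is finite with identity $1$. The $\mathcal R$-order is $a\leq b$ iff $ba=a$. $B$ is geometric if for each $a\in B$ the set $\{b\in B: b\geq a\}$ is commutative. $\mathscr M(B)$ is the set of maximal elements of $B\setminus\{1\}$ in the $\mathcal R$-order; the commutation graph $\Gamma(\mathscr M(B))$ has vertex set $\mathscr M(B)$ and an edge $\{a,b\}$ whenever $ab=ba$. The clique complex $\mathsf{Cliq}(G)$ of a simple graph $G$ is the simplicial complex whose simplices are the vertex sets of complete subgraphs of $G$. *)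

theory Defs
  imports "HOL-Analysis.Analysis" "HOL-Algebra.Group"
begin

section \<open>Left regular band monoids\<close>

locale left_regular_band_monoid = monoid B for B (structure) +
  assumes idem: "x \<in> carrier B \<Longrightarrow> x \<otimes> x = x"
    and left_regular: "\<lbrakk>x \<in> carrier B; y \<in> carrier B\<rbrakk> \<Longrightarrow> x \<otimes> y \<otimes> x = x \<otimes> y"

definition R_le :: "('a, 'm) monoid_scheme \<Rightarrow> 'a \<Rightarrow> 'a \<Rightarrow> bool" where
  "R_le B a b \<longleftrightarrow> b \<otimes>\<^bsub>B\<^esub> a = a"

lemma (in left_regular_band_monoid) R_le_partial_order:
  shows "a \<in> carrier B \<Longrightarrow> R_le B a a"
    and "\<lbrakk>a \<in> carrier B; b \<in> carrier B; R_le B a b; R_le B b a\<rbrakk> \<Longrightarrow> a = b"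
    and "\<lbrakk>a \<in> carrier B; b \<in> carrier B; c \<in> carrier B; R_le B a b; R_le B b c\<rbrakk> \<Longrightarrow> R_le B a c"
  unfolding R_le_def
  using idem left_regular m_assoc by metis+

locale geometric_left_regular_band_monoid = left_regular_band_monoid +
  assumes geometric: "\<lbrakk>a \<in> carrier B; b \<in> carrier B; c \<in> carrier B; R_le B a b; R_le B a c\<rbrakk>
    \<Longrightarrow> b \<otimes> c = c \<otimes> b"

definition maximal_nonidentity :: "('a, 'm) monoid_scheme \<Rightarrow> 'a set" where
  "maximal_nonidentity B =
    {a \<in> carrier B - {\<one>\<^bsub>B\<^esub>}. \<forall>b \<in> carrier B - {\<one>\<^bsub>B\<^esub>}. R_le B a b \<longrightarrow> b = a}"


section \<open>Simple graphs and simplicial complexes\<close>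

text \<open>A simple graph is a pair of a vertex set and a set of two-element sets of vertices.\<close>

type_synonym 'a simple_graph = "'a set \<times> 'a set set"

definition commutation_graph :: "('a, 'm) monoid_scheme \<Rightarrow> 'a set \<Rightarrow> 'a simple_graph" where
  "commutation_graph B V =
    (V, {{a, b} | a b. a \<in> V \<and> b \<in> V \<and> a \<noteq> b \<and> a \<otimes>\<^bsub>B\<^esub> b = b \<otimes>\<^bsub>B\<^esub> a})"

text \<open>An abstract simplicial complex is given by its set of nonempty finite simplices.\<close>

definition clique_complex :: "'a simple_graph \<Rightarrow> 'a set set" where
  "clique_complex G =
    {s. finite s \<and> s \<noteq> {} \<and> s \<subseteq> fst G \<and> (\<forall>a \<in> s. \<forall>b \<in> s. a \<noteq> b \<longrightarrow> {a, b} \<in> snd G)}"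

definition order_complex :: "'a set \<Rightarrow> ('a \<Rightarrow> 'a \<Rightarrow> bool) \<Rightarrow> 'a set set" where
  "order_complex P r = {s. finite s \<and> s \<noteq> {} \<and> s \<subseteq> P \<and> Complete_Partial_Order.chain r s}"

text \<open>
  Points are given by barycentric coordinates, extended by zero to the whole type. The topology is
  that of pointwise convergence; it is the usual (weak) topology of the realization when the
  complex is finite, but in general not for infinite complexes.
\<close>

definition geometric_realization :: "'a set set \<Rightarrow> ('a \<Rightarrow> real) topology" where
  "geometric_realization K = subtopology (powertop_real UNIV)
    {x. (\<forall>v. 0 \<le> x v) \<and> {v. x v \<noteq> 0} \<in> K \<and> (\<Sum>v | x v \<noteq> 0. x v) = 1}"

end

theory Submission imports Defs begin

text \<open>
  The products of commuting maximal elements are their meets, and geometricity says that elements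
  with a common lower bound commute. So the cliques are the nonempty sets of maximal elements
  bounded below in \<open>P = B - {1}\<close>, and the theorem is an instance of the crosscut theorem.

  For the latter, write \<open>M\<^sub>a\<close> for the set of \<open>m \<in> M\<close> above \<open>a\<close>. One map spreads the mass of a vertex
  \<open>a \<in> P\<close> evenly over \<open>M\<^sub>a\<close>; the other is a version of the barycentric subdivision followed by
  \<open>S \<mapsto> \<And>S\<close>. The composite on the crosscut complex is joined to the identity by segments inside
  simplices. The composite on the order complex is similarly joined to the map induced by the closure
  operator \<open>a \<mapsto> \<And>M\<^sub>a\<close>, and this one is deformed to the identity by moving the vertices of a chain
  one after the other, the largest one first.
\<close>

section \<open>Maps into geometric realizations\<close>

lemma topspace_geometric_realization:
  "topspace (geometric_realization K) =
    {x. (\<forall>v. 0 \<le> x v) \<and> {v. x v \<noteq> 0} \<in> K \<and> (\<Sum>v | x v \<noteq> 0. x v) = 1}"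
  by (simp add: geometric_realization_def)

lemma geometric_realization_sum:
  assumes "x \<in> topspace (geometric_realization K)" "finite P" "\<And>s. s \<in> K \<Longrightarrow> s \<subseteq> P"
  shows "sum x P = 1"
proof -
  have "sum x P = (\<Sum>v | x v \<noteq> 0. x v)"
    by (rule sum.mono_neutral_right) (use assms in \<open>auto simp: topspace_geometric_realization\<close>)
  then show ?thesis
    using assms(1) by (simp add: topspace_geometric_realization)
qed

lemma continuous_map_coordinate:
  "continuous_map (geometric_realization K) euclideanreal (\<lambda>x. x a)"
  unfolding geometric_realization_def
  by (intro continuous_map_from_subtopology continuous_map_product_projection) simp

text \<open>The push-forward of a weight \<open>w\<close> on indices along \<open>v\<close>; several
  indices may name the same vertex, and their weights add up. The maps \<open>to_crosscut\<close>,
  \<open>to_order\<close>, \<open>closure_map\<close> and the homotopy in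
  \<open>closure_map_homotopic_id\<close> all have this form, with \<open>v\<close> fixed and
  \<open>w\<close> varying, so \<open>continuous_map_push\<close> handles them uniformly.\<close>

definition push :: "'i set \<Rightarrow> ('i \<Rightarrow> 'b) \<Rightarrow> ('i \<Rightarrow> real) \<Rightarrow> 'b \<Rightarrow> real" where
  "push I v w q = (\<Sum>i | i \<in> I \<and> v i = q. w i)"

text \<open>Nonnegative weights cannot cancel.\<close>

lemma support_push:
  assumes "finite I" "\<And>i. i \<in> I \<Longrightarrow> 0 \<le> w i"
  shows "{q. push I v w q \<noteq> 0} = v ` {i \<in> I. w i \<noteq> 0}"
proof -
  have "push I v w q = 0 \<longleftrightarrow> (\<forall>i\<in>{i \<in> I. v i = q}. w i = 0)" for q
    unfolding push_def by (rule sum_nonneg_eq_0_iff) (use assms in auto)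
  then show ?thesis by auto
qed

lemma push_in_geometric_realization:
  assumes "finite I" "\<And>i. i \<in> I \<Longrightarrow> 0 \<le> w i" "sum w I = 1" "v ` {i \<in> I. w i \<noteq> 0} \<in> K"
  shows "push I v w \<in> topspace (geometric_realization K)"
proof -
  have supp: "{q. push I v w q \<noteq> 0} = v ` {i \<in> I. w i \<noteq> 0}"
    by (rule support_push) (use assms in auto)
  have "(\<Sum>q | push I v w q \<noteq> 0. push I v w q) = (\<Sum>q\<in>v ` I. push I v w q)"
    by (rule sum.mono_neutral_left) (use assms(1) supp in auto)
  also have "\<dots> = sum w I"
    unfolding push_def using assms(1) by (simp add: sum.image_gen[symmetric])
  finally have "(\<Sum>q | push I v w q \<noteq> 0. push I v w q) = 1"
    using assms(3) by simp
  moreover have "0 \<le> push I v w q" for q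
    unfolding push_def by (rule sum_nonneg) (use assms in auto)
  ultimately show ?thesis
    using supp assms(4) by (simp add: topspace_geometric_realization)
qed

lemma continuous_map_push:
  assumes "finite I" "\<And>i. i \<in> I \<Longrightarrow> continuous_map X euclideanreal (\<lambda>x. w x i)"
    and "\<And>x i. x \<in> topspace X \<Longrightarrow> i \<in> I \<Longrightarrow> 0 \<le> w x i"
    and "\<And>x. x \<in> topspace X \<Longrightarrow> sum (w x) I = 1"
    and "\<And>x. x \<in> topspace X \<Longrightarrow> v ` {i \<in> I. w x i \<noteq> 0} \<in> K"
  shows "continuous_map X (geometric_realization K) (\<lambda>x. push I v (w x))"
proof -
  have "continuous_map X (powertop_real UNIV) (\<lambda>x. push I v (w x))"
    unfolding continuous_map_componentwise_UNIV push_def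
    by (intro allI continuous_map_sum) (use assms in auto)
  moreover have "push I v (w x) \<in> topspace (geometric_realization K)" if "x \<in> topspace X" for x
    by (rule push_in_geometric_realization) (use assms that in auto)
  ultimately show ?thesis
    unfolding geometric_realization_def continuous_map_in_subtopology
    by (auto simp: topspace_geometric_realization)
qed

text \<open>Contiguity: the segment from \<open>f x\<close> to \<open>g x\<close> stays in the
  closed simplex spanned by \<open>s\<close>, and every nonempty subset of \<open>s\<close> is again
  a simplex.\<close>

lemma homotopic_with_linear_geometric_realization:
  assumes f: "continuous_map X (geometric_realization K) f"
    and g: "continuous_map X (geometric_realization K) g"
    and fin: "\<And>s. s \<in> K \<Longrightarrow> finite s"
    and down: "\<And>s t. s \<in> K \<Longrightarrow> t \<subseteq> s \<Longrightarrow> t \<noteq> {} \<Longrightarrow> t \<in> K"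
    and common: "\<And>x. x \<in> topspace X \<Longrightarrow> \<exists>s\<in>K. {v. f x v \<noteq> 0} \<subseteq> s \<and> {v. g x v \<noteq> 0} \<subseteq> s"
  shows "homotopic_with (\<lambda>_. True) X (geometric_realization K) f g"
proof -
  let ?Z = "prod_topology (top_of_set {0..1::real}) X"
  define h where "h = (\<lambda>(t, x) v. (1 - t) * f x v + t * g x v)"
  have "h (t, x) \<in> topspace (geometric_realization K)"
    if t: "t \<in> {0..1}" and x: "x \<in> topspace X" for t x
  proof -
    obtain s where s: "s \<in> K" "{v. f x v \<noteq> 0} \<subseteq> s" "{v. g x v \<noteq> 0} \<subseteq> s"
      using common[OF x] by blast
    have fx: "f x \<in> topspace (geometric_realization K)"
      and gx: "g x \<in> topspace (geometric_realization K)"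
      using continuous_map_image_subset_topspace[OF f] continuous_map_image_subset_topspace[OF g] x
      by blast+
    \<comment> \<open>Summing over the common simplex \<open>s\<close> instead of the two supports
      makes the coordinate sums affine in \<open>t\<close>.\<close>
    have "sum (f x) s = (\<Sum>v | f x v \<noteq> 0. f x v)" "sum (g x) s = (\<Sum>v | g x v \<noteq> 0. g x v)"
      by (rule sum.mono_neutral_right; use s fin in auto)+
    then have "sum (f x) s = 1" "sum (g x) s = 1"
      using fx gx by (auto simp: topspace_geometric_realization)
    then have one: "sum (h (t, x)) s = 1"
      by (simp add: h_def sum.distrib sum_distrib_left[symmetric])
    have "h (t, x) v = 0" if "v \<notin> s" for v
    proof -
      have "f x v = 0" "g x v = 0" using s(2,3) that by blast+
      then show ?thesis by (simp add: h_def)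
    qed
    then have sub: "{v. h (t, x) v \<noteq> 0} \<subseteq> s"
      by blast
    have "(\<Sum>v | h (t, x) v \<noteq> 0. h (t, x) v) = sum (h (t, x)) s"
      by (rule sum.mono_neutral_left) (use s fin sub in auto)
    moreover have "{v. h (t, x) v \<noteq> 0} \<noteq> {}"
    proof
      assume "{v. h (t, x) v \<noteq> 0} = {}"
      then have "sum (h (t, x)) s = 0" by (intro sum.neutral) auto
      with one show False by simp
    qed
    then have "{v. h (t, x) v \<noteq> 0} \<in> K"
      using down[OF s(1) sub] by simp
    moreover have "0 \<le> h (t, x) v" for v
      using fx gx t by (auto simp: h_def topspace_geometric_realization)
    ultimately show ?thesis
      using one by (simp add: topspace_geometric_realization)
  qed
  moreover have "continuous_map ?Z (powertop_real UNIV) h"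
    unfolding continuous_map_componentwise_UNIV
  proof
    fix v
    have c: "continuous_map ?Z euclideanreal (\<lambda>z. f (snd z) v)"
      "continuous_map ?Z euclideanreal (\<lambda>z. g (snd z) v)"
      using continuous_map_compose[OF continuous_map_snd
          continuous_map_compose[OF f continuous_map_coordinate[of K v]]]
        continuous_map_compose[OF continuous_map_snd
          continuous_map_compose[OF g continuous_map_coordinate[of K v]]]
      by (simp_all add: o_def)
    have t: "continuous_map ?Z euclideanreal fst"
      using continuous_map_fst continuous_map_into_fulltopology by blast
    have "continuous_map ?Z euclideanreal (\<lambda>z. (1 - fst z) * f (snd z) v + fst z * g (snd z) v)"
      by (intro continuous_map_add continuous_map_real_mult continuous_map_diff c t) simp
    then show "continuous_map ?Z euclideanreal (\<lambda>z. h z v)"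
      by (simp add: h_def case_prod_beta)
  qed
  ultimately have "continuous_map ?Z (geometric_realization K) h"
    unfolding geometric_realization_def continuous_map_in_subtopology
    by (auto simp: topspace_geometric_realization)
  then show ?thesis
    unfolding homotopic_with_def by (intro exI[of _ h]) (auto simp: h_def)
qed

section \<open>The crosscut theorem\<close>

text \<open>Meets are required only for subsets of \<open>M\<close> with a lower bound in
  \<open>P\<close>; these are the meets that products of commuting elements will supply.\<close>

locale crosscut =
  fixes P :: "'a set" and le :: "'a \<Rightarrow> 'a \<Rightarrow> bool" (infix \<open>\<preceq>\<close> 50) and M :: "'a set"
  assumes finite_P: "finite P"
    and refl: "a \<in> P \<Longrightarrow> a \<preceq> a"
    and antisym: "a \<in> P \<Longrightarrow> b \<in> P \<Longrightarrow> a \<preceq> b \<Longrightarrow> b \<preceq> a \<Longrightarrow> a = b"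
    and trans: "a \<in> P \<Longrightarrow> b \<in> P \<Longrightarrow> c \<in> P \<Longrightarrow> a \<preceq> b \<Longrightarrow> b \<preceq> c \<Longrightarrow> a \<preceq> c"
    and M_subset: "M \<subseteq> P"
    and below_M: "a \<in> P \<Longrightarrow> \<exists>m\<in>M. a \<preceq> m"
    and ex_meet: "S \<subseteq> M \<Longrightarrow> S \<noteq> {} \<Longrightarrow> a \<in> P \<Longrightarrow> (\<And>s. s \<in> S \<Longrightarrow> a \<preceq> s) \<Longrightarrow>
      \<exists>p\<in>P. (\<forall>s\<in>S. p \<preceq> s) \<and> (\<forall>b\<in>P. (\<forall>s\<in>S. b \<preceq> s) \<longrightarrow> b \<preceq> p)"
begin

section \<open>Meets of subsets of \<open>M\<close> and the closure operator\<close>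

definition crosscut_complex :: "'a set set" where
  "crosscut_complex = {S. S \<subseteq> M \<and> S \<noteq> {} \<and> (\<exists>a\<in>P. \<forall>s\<in>S. a \<preceq> s)}"

abbreviation "\<Delta> \<equiv> geometric_realization (order_complex P (\<preceq>))"
abbreviation "\<Gamma> \<equiv> geometric_realization crosscut_complex"

definition meet_M :: "'a set \<Rightarrow> 'a" where
  "meet_M S = (SOME p. p \<in> P \<and> (\<forall>s\<in>S. p \<preceq> s) \<and> (\<forall>b\<in>P. (\<forall>s\<in>S. b \<preceq> s) \<longrightarrow> b \<preceq> p))"

definition above_M :: "'a \<Rightarrow> 'a set" where
  "above_M a = {m \<in> M. a \<preceq> m}"

abbreviation cl :: "'a \<Rightarrow> 'a" where
  "cl a \<equiv> meet_M (above_M a)"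

lemma finite_M: "finite M"
  using finite_P M_subset finite_subset by blast

lemma
  assumes "S \<in> crosscut_complex"
  shows meet_in: "meet_M S \<in> P"
    and meet_le: "s \<in> S \<Longrightarrow> meet_M S \<preceq> s"
    and meet_greatest: "b \<in> P \<Longrightarrow> (\<And>s. s \<in> S \<Longrightarrow> b \<preceq> s) \<Longrightarrow> b \<preceq> meet_M S"
proof -
  have "\<exists>p. p \<in> P \<and> (\<forall>s\<in>S. p \<preceq> s) \<and> (\<forall>b\<in>P. (\<forall>s\<in>S. b \<preceq> s) \<longrightarrow> b \<preceq> p)"
    using ex_meet[of S] assms unfolding crosscut_complex_def by blast
  from someI_ex[OF this]
  show "meet_M S \<in> P" "s \<in> S \<Longrightarrow> meet_M S \<preceq> s"
    "b \<in> P \<Longrightarrow> (\<And>s. s \<in> S \<Longrightarrow> b \<preceq> s) \<Longrightarrow> b \<preceq> meet_M S"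
    unfolding meet_M_def by blast+
qed

lemma crosscut_complex_mono: "T \<in> crosscut_complex \<Longrightarrow> S \<subseteq> T \<Longrightarrow> S \<noteq> {} \<Longrightarrow> S \<in> crosscut_complex"
  unfolding crosscut_complex_def by blast

lemma meet_antimono:
  assumes "S \<subseteq> T" "S \<noteq> {}" "T \<in> crosscut_complex"
  shows "meet_M T \<preceq> meet_M S"
  using assms
  by (intro meet_greatest[OF crosscut_complex_mono[OF assms(3,1,2)]] meet_in[OF assms(3)]
      meet_le[OF assms(3)]) auto

lemma above_in: "a \<in> P \<Longrightarrow> above_M a \<in> crosscut_complex"
  using below_M unfolding crosscut_complex_def above_M_def by blast

lemma above_antimono: "a \<in> P \<Longrightarrow> b \<in> P \<Longrightarrow> a \<preceq> b \<Longrightarrow> above_M b \<subseteq> above_M a"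
  using trans M_subset unfolding above_M_def by blast

lemma card_above_pos: "a \<in> P \<Longrightarrow> 0 < card (above_M a)"
  using below_M finite_M unfolding above_M_def by (auto simp: card_gt_0_iff)

lemma cl_in: "a \<in> P \<Longrightarrow> cl a \<in> P"
  by (simp add: above_in meet_in)

lemma le_cl: "a \<in> P \<Longrightarrow> a \<preceq> cl a"
  by (rule meet_greatest[OF above_in]) (auto simp: above_M_def)

lemma cl_mono:
  assumes "a \<in> P" "b \<in> P" "a \<preceq> b"
  shows "cl a \<preceq> cl b"
  by (rule meet_antimono[OF above_antimono[OF assms] _ above_in[OF assms(1)]])
    (use above_in[OF assms(2)] in \<open>simp add: crosscut_complex_def\<close>)

lemma in_order_complexI:
  assumes "S \<subseteq> P" "S \<noteq> {}" "\<And>a b. a \<in> S \<Longrightarrow> b \<in> S \<Longrightarrow> a \<preceq> b \<or> b \<preceq> a"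
  shows "S \<in> order_complex P (\<preceq>)"
  using assms finite_subset[OF _ finite_P] by (auto simp: order_complex_def chain_def)

lemma order_complex_mono:
  "s \<in> order_complex P (\<preceq>) \<Longrightarrow> t \<subseteq> s \<Longrightarrow> t \<noteq> {} \<Longrightarrow> t \<in> order_complex P (\<preceq>)"
  by (auto simp: order_complex_def chain_def intro: finite_subset)

lemma
  assumes "x \<in> topspace \<Delta>"
  shows \<Delta>_nonneg: "0 \<le> x a"
    and \<Delta>_in: "x a \<noteq> 0 \<Longrightarrow> a \<in> P"
    and \<Delta>_chain: "x a \<noteq> 0 \<Longrightarrow> x b \<noteq> 0 \<Longrightarrow> a \<preceq> b \<or> b \<preceq> a"
    and \<Delta>_ex: "\<exists>a. x a \<noteq> 0"
    and \<Delta>_sum: "sum x P = 1"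
  using assms geometric_realization_sum[OF assms finite_P]
  by (auto simp: topspace_geometric_realization order_complex_def chain_def)

lemma
  assumes "y \<in> topspace \<Gamma>"
  shows \<Gamma>_nonneg: "0 \<le> y m"
    and \<Gamma>_supp: "{m. y m \<noteq> 0} \<in> crosscut_complex"
    and \<Gamma>_ex: "\<exists>m\<in>M. y m \<noteq> 0"
  using assms by (auto simp: topspace_geometric_realization crosscut_complex_def)

section \<open>The map from the order complex to the crosscut complex\<close>

text \<open>Indexing by pairs keeps the shares coming from different vertices \<open>a\<close> apart
  until the push-forward along \<open>snd\<close> adds them up at \<open>m\<close>.\<close>

definition spread :: "('a \<Rightarrow> real) \<Rightarrow> 'a \<times> 'a \<Rightarrow> real" where
  "spread x = (\<lambda>(a, m). if a \<preceq> m then x a / card (above_M a) else 0)"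

definition to_crosscut :: "('a \<Rightarrow> real) \<Rightarrow> 'a \<Rightarrow> real" where
  "to_crosscut x = push (P \<times> M) snd (spread x)"

lemma spread_nonneg: "x \<in> topspace \<Delta> \<Longrightarrow> 0 \<le> spread x i"
  by (auto simp: spread_def \<Delta>_nonneg split: prod.split)

lemma support_to_crosscut:
  assumes x: "x \<in> topspace \<Delta>"
  shows "{m. to_crosscut x m \<noteq> 0} = (\<Union>a\<in>{a. x a \<noteq> 0}. above_M a)"
proof -
  have "{m. to_crosscut x m \<noteq> 0} = snd ` {i \<in> P \<times> M. spread x i \<noteq> 0}"
    unfolding to_crosscut_def
    by (rule support_push) (use finite_P finite_M spread_nonneg[OF x] in auto)
  also have "\<dots> = (\<Union>a\<in>{a. x a \<noteq> 0}. above_M a)"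
    using \<Delta>_in[OF x] card_above_pos
    by (force simp: spread_def above_M_def image_iff split: if_splits)
  finally show ?thesis .
qed

text \<open>A finite chain has a least element \<open>a\<close>. Since \<open>above_M\<close>
  reverses the order, the union is just \<open>above_M a\<close>.\<close>

lemma UN_above_in:
  assumes C: "C \<in> order_complex P (\<preceq>)"
  shows "(\<Union>a\<in>C. above_M a) \<in> crosscut_complex"
proof -
  have C': "finite C" "C \<noteq> {}" "C \<subseteq> P" "\<And>a b. a \<in> C \<Longrightarrow> b \<in> C \<Longrightarrow> a \<preceq> b \<or> b \<preceq> a"
    using C by (auto simp: order_complex_def chain_def)
  then have "\<exists>a\<in>C. \<forall>b\<in>C. a \<preceq> b"
  proof (induction C rule: finite_ne_induct)
    case (singleton a) then show ?case using refl by auto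
  next
    case (insert c C)
    then obtain a where a: "a \<in> C" "\<forall>b\<in>C. a \<preceq> b" by auto
    then show ?case
      using insert.prems refl trans
      by (smt (verit) insert_iff subset_iff)
  qed
  then obtain a where a: "a \<in> C" "\<forall>b\<in>C. a \<preceq> b" by blast
  then have "(\<Union>b\<in>C. above_M b) = above_M a"
    using above_antimono C' by blast
  then show ?thesis using above_in a C' by auto
qed

lemma continuous_map_to_crosscut: "continuous_map \<Delta> \<Gamma> to_crosscut"
  unfolding to_crosscut_def
proof (rule continuous_map_push)
  show "finite (P \<times> M)" using finite_P finite_M by simp
  show "continuous_map \<Delta> euclideanreal (\<lambda>x. spread x i)" for i
    by (cases i) (auto simp: spread_def divide_inverse
        intro!: continuous_map_real_mult continuous_map_coordinate)
  fix x assume x: "x \<in> topspace \<Delta>"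
  show "0 \<le> spread x i" for i by (rule spread_nonneg[OF x])
  have "sum (spread x) (P \<times> M) = (\<Sum>a\<in>P. \<Sum>m\<in>M. if a \<preceq> m then x a / card (above_M a) else 0)"
    by (simp add: sum.cartesian_product spread_def)
  also have "\<dots> = (\<Sum>a\<in>P. x a)"
  proof (rule sum.cong)
    fix a assume "a \<in> P"
    have "(\<Sum>m\<in>M. if a \<preceq> m then x a / card (above_M a) else 0) =
      (\<Sum>m\<in>above_M a. x a / card (above_M a))"
      unfolding above_M_def by (rule sum.inter_filter[symmetric, OF finite_M])
    \<comment> \<open>The division is by a positive number because \<open>above_M a\<close> is
      nonempty, so the equal shares add up to \<open>x a\<close>.\<close>
    then show "(\<Sum>m\<in>M. if a \<preceq> m then x a / card (above_M a) else 0) = x a"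
      using card_above_pos[OF \<open>a \<in> P\<close>] by simp
  qed simp
  finally show "sum (spread x) (P \<times> M) = 1" using \<Delta>_sum[OF x] by simp
  have "snd ` {i \<in> P \<times> M. spread x i \<noteq> 0} = {m. to_crosscut x m \<noteq> 0}"
    unfolding to_crosscut_def
    by (rule support_push[symmetric]) (use finite_P finite_M spread_nonneg[OF x] in auto)
  also have "\<dots> \<in> crosscut_complex"
    unfolding support_to_crosscut[OF x]
    by (rule UN_above_in) (use x in \<open>simp add: topspace_geometric_realization\<close>)
  finally show "snd ` {i \<in> P \<times> M. spread x i \<noteq> 0} \<in> crosscut_complex" .
qed

section \<open>The map from the crosscut complex to the order complex\<close>

text \<open>
  The level weight of \<open>S\<close> is nonzero iff \<open>S\<close> is a superlevel set of \<open>y\<close> at a positive level.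
\<close>

definition level_weight :: "('a \<Rightarrow> real) \<Rightarrow> 'a set \<Rightarrow> real" where
  "level_weight y S = (\<Prod>s\<in>S. y s * (\<Prod>m\<in>M - S. max 0 (y s - y m)))"

text \<open>An index set for \<open>push\<close> that does not depend on \<open>y\<close>. At a
  point of \<open>\<Gamma>\<close> the members without a lower bound in \<open>P\<close> get weight
  zero, by \<open>level_weight_nonzero_in\<close>.\<close>

definition faces :: "'a set set" where
  "faces = {S. S \<subseteq> M \<and> S \<noteq> {}}"

text \<open>The level weights are continuous in \<open>y\<close> but need not add up to 1, hence the
  normalization.\<close>

definition to_order :: "('a \<Rightarrow> real) \<Rightarrow> 'a \<Rightarrow> real" where
  "to_order y = push faces meet_M (\<lambda>S. level_weight y S / sum (level_weight y) faces)"

lemma finite_faces: "finite faces"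
  by (rule finite_subset[of _ "Pow M"]) (auto simp: faces_def finite_M)

lemma level_weight_nonneg: "y \<in> topspace \<Gamma> \<Longrightarrow> 0 \<le> level_weight y S"
  unfolding level_weight_def by (intro prod_nonneg mult_nonneg_nonneg) (auto simp: \<Gamma>_nonneg)

lemma level_weight_nonzero_iff:
  assumes "S \<in> faces"
  shows "level_weight y S \<noteq> 0 \<longleftrightarrow> (\<forall>s\<in>S. y s \<noteq> 0 \<and> (\<forall>m\<in>M - S. y m < y s))"
proof -
  have "finite S" using assms finite_M by (auto simp: faces_def intro: finite_subset)
  moreover have "max 0 (y s - y m) \<noteq> 0 \<longleftrightarrow> y m < y s" for s m by auto
  ultimately show ?thesis
    using finite_M by (simp add: level_weight_def)
qed

text \<open>The set of all points of \<open>M\<close> where \<open>y\<close> is maximal has nonzero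
  weight: the maximum is positive, and including every maximizer makes the inequality strict outside
  the set.\<close>

lemma sum_level_weight_pos:
  assumes y: "y \<in> topspace \<Gamma>"
  shows "0 < sum (level_weight y) faces"
proof -
  obtain m where m: "m \<in> M" "y m \<noteq> 0" using \<Gamma>_ex[OF y] by blast
  have "Max (y ` M) \<in> y ` M" using finite_M m by (intro Max_in) auto
  then obtain s where s: "s \<in> M" "y s = Max (y ` M)" by auto
  have le: "y n \<le> y s" if "n \<in> M" for n using that finite_M s by simp
  define S where "S = {n \<in> M. y n = y s}"
  have S: "S \<in> faces" using s by (auto simp: faces_def S_def)
  have "y s \<noteq> 0" using le[OF m(1)] m \<Gamma>_nonneg[OF y, of m] by linarith
  then have "level_weight y S \<noteq> 0"
    using level_weight_nonzero_iff[OF S] le by (force simp: S_def)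
  then show ?thesis
    using S finite_faces level_weight_nonneg[OF y] by (intro sum_pos2) (auto simp: less_le)
qed

lemma support_to_order:
  assumes y: "y \<in> topspace \<Gamma>"
  shows "{a. to_order y a \<noteq> 0} = meet_M ` {S \<in> faces. level_weight y S \<noteq> 0}"
proof -
  have "{a. to_order y a \<noteq> 0} =
      meet_M ` {S \<in> faces. level_weight y S / sum (level_weight y) faces \<noteq> 0}"
    unfolding to_order_def using sum_level_weight_pos[OF y]
    by (intro support_push) (auto simp: finite_faces level_weight_nonneg[OF y])
  then show ?thesis using sum_level_weight_pos[OF y] by simp
qed

lemma level_weight_nonzero_subset:
  assumes "S \<in> faces" "level_weight y S \<noteq> 0"
  shows "S \<subseteq> {m. y m \<noteq> 0}"
  using assms level_weight_nonzero_iff by blast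

lemma level_weight_nonzero_in:
  assumes "y \<in> topspace \<Gamma>" "S \<in> faces" "level_weight y S \<noteq> 0"
  shows "S \<in> crosscut_complex"
  using crosscut_complex_mono[OF \<Gamma>_supp[OF assms(1)] level_weight_nonzero_subset[OF assms(2,3)]]
    assms(2) by (auto simp: faces_def)

text \<open>Superlevel sets of one function are nested: points of the two differences would each
  have a strictly larger value than the other.\<close>

lemma level_weight_nonzero_nested:
  assumes "S \<in> faces" "T \<in> faces" "level_weight y S \<noteq> 0" "level_weight y T \<noteq> 0"
  shows "S \<subseteq> T \<or> T \<subseteq> S"
proof (rule ccontr)
  assume "\<not> (S \<subseteq> T \<or> T \<subseteq> S)"
  then obtain s t where "s \<in> S - T" "t \<in> T - S" by blast
  then have "y t < y s" "y s < y t"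
    using assms level_weight_nonzero_iff[of S y] level_weight_nonzero_iff[of T y]
    by (auto simp: faces_def)
  then show False by simp
qed

lemma meet_nested:
  assumes "S \<in> crosscut_complex" "T \<in> crosscut_complex" "S \<subseteq> T \<or> T \<subseteq> S"
  shows "meet_M S \<preceq> meet_M T \<or> meet_M T \<preceq> meet_M S"
  using assms meet_antimono[of S T] meet_antimono[of T S] by (auto simp: crosscut_complex_def)

lemma continuous_map_to_order: "continuous_map \<Gamma> \<Delta> to_order"
  unfolding to_order_def
proof (rule continuous_map_push)
  show "finite faces" by (rule finite_faces)
  \<comment> \<open>For infinite \<open>S\<close> the product has the default value 1 and the
    function is constant.\<close>
  have c: "continuous_map \<Gamma> euclideanreal (\<lambda>y. level_weight y S)" for S
    unfolding level_weight_def
  proof (cases "finite S")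
    case True
    then show "continuous_map \<Gamma> euclideanreal (\<lambda>y. \<Prod>s\<in>S. y s * (\<Prod>m\<in>M - S. max 0 (y s - y m)))"
      by (intro continuous_map_prod continuous_map_real_mult continuous_map_real_max
          continuous_map_diff continuous_map_coordinate) (auto simp: finite_M)
  qed simp
  show "continuous_map \<Gamma> euclideanreal (\<lambda>y. level_weight y S / sum (level_weight y) faces)" for S
    by (intro continuous_map_real_divide continuous_map_sum c finite_faces)
      (use sum_level_weight_pos in force)
  fix y assume y: "y \<in> topspace \<Gamma>"
  note pos = sum_level_weight_pos[OF y]
  show "0 \<le> level_weight y S / sum (level_weight y) faces" for S
    using level_weight_nonneg[OF y] pos by simp
  show "(\<Sum>S\<in>faces. level_weight y S / sum (level_weight y) faces) = 1"
    using pos by (simp add: sum_divide_distrib[symmetric])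
  \<comment> \<open>The faces of nonzero weight are nested and \<open>meet_M\<close> reverses
    inclusions, so their meets form a chain.\<close>
  have "meet_M ` {S \<in> faces. level_weight y S \<noteq> 0} \<in> order_complex P (\<preceq>)"
  proof (rule in_order_complexI)
    show "meet_M ` {S \<in> faces. level_weight y S \<noteq> 0} \<subseteq> P"
      using meet_in level_weight_nonzero_in[OF y] by blast
    show "meet_M ` {S \<in> faces. level_weight y S \<noteq> 0} \<noteq> {}"
      using pos by (metis (mono_tags, lifting) empty_iff image_is_empty less_irrefl mem_Collect_eq sum.neutral)
    fix a b
    assume "a \<in> meet_M ` {S \<in> faces. level_weight y S \<noteq> 0}"
      "b \<in> meet_M ` {S \<in> faces. level_weight y S \<noteq> 0}"
    then obtain S T where ST: "a = meet_M S" "b = meet_M T" "S \<in> faces" "T \<in> faces"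
      "level_weight y S \<noteq> 0" "level_weight y T \<noteq> 0" by blast
    then show "a \<preceq> b \<or> b \<preceq> a"
      using meet_nested[OF level_weight_nonzero_in[OF y] level_weight_nonzero_in[OF y]]
        level_weight_nonzero_nested by simp
  qed
  then show "meet_M ` {S \<in> faces. level_weight y S / sum (level_weight y) faces \<noteq> 0}
      \<in> order_complex P (\<preceq>)"
    using pos by simp
qed

section \<open>The composite on the crosscut complex\<close>

text \<open>Let \<open>?S\<close> be the support of \<open>y\<close>. Each face \<open>T\<close> of
  nonzero weight lies in \<open>?S\<close>, so its meet is above \<open>meet_M ?S\<close> and only
  elements of \<open>above_M (meet_M ?S)\<close> receive mass. This simplex also contains
  \<open>?S\<close>, so a linear homotopy works.\<close>

lemma to_crosscut_to_order_homotopic: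
  "homotopic_with (\<lambda>_. True) \<Gamma> \<Gamma> (to_crosscut \<circ> to_order) id"
proof (rule homotopic_with_linear_geometric_realization)
  show "continuous_map \<Gamma> \<Gamma> (to_crosscut \<circ> to_order)"
    by (rule continuous_map_compose[OF continuous_map_to_order continuous_map_to_crosscut])
  show "finite s" if "s \<in> crosscut_complex" for s
    using that finite_subset[OF _ finite_M] by (auto simp: crosscut_complex_def)
  fix y assume y: "y \<in> topspace \<Gamma>"
  let ?S = "{m. y m \<noteq> 0}"
  have oy: "to_order y \<in> topspace \<Delta>"
    using continuous_map_image_subset_topspace[OF continuous_map_to_order] y by blast
  have S: "?S \<in> crosscut_complex" by (rule \<Gamma>_supp[OF y])
  have "above_M (meet_M T) \<subseteq> above_M (meet_M ?S)" if "T \<in> faces" "level_weight y T \<noteq> 0" for T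
    using that meet_antimono[OF level_weight_nonzero_subset _ S] above_antimono meet_in S
      level_weight_nonzero_in[OF y] by (simp add: faces_def)
  then have "{m. to_crosscut (to_order y) m \<noteq> 0} \<subseteq> above_M (meet_M ?S)"
    unfolding support_to_crosscut[OF oy] support_to_order[OF y] by blast
  moreover have "?S \<subseteq> above_M (meet_M ?S)"
    using S meet_le[OF S] by (auto simp: above_M_def crosscut_complex_def)
  ultimately show "\<exists>s\<in>crosscut_complex. {m. (to_crosscut \<circ> to_order) y m \<noteq> 0} \<subseteq> s \<and>
      {m. id y m \<noteq> 0} \<subseteq> s"
    using above_in[OF meet_in[OF S]] by auto
qed (simp_all add: continuous_map_id crosscut_complex_mono)

section \<open>The composite on the order complex and the closure map\<close>

definition closure_map :: "('a \<Rightarrow> real) \<Rightarrow> 'a \<Rightarrow> real" where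
  "closure_map x = push P cl x"

lemma support_closure_map:
  assumes x: "x \<in> topspace \<Delta>"
  shows "{a. closure_map x a \<noteq> 0} = cl ` {a. x a \<noteq> 0}"
proof -
  have "{a. closure_map x a \<noteq> 0} = cl ` {a \<in> P. x a \<noteq> 0}"
    unfolding closure_map_def by (rule support_push) (use finite_P \<Delta>_nonneg[OF x] in auto)
  then show ?thesis using \<Delta>_in[OF x] by blast
qed

lemma continuous_map_closure_map: "continuous_map \<Delta> \<Delta> closure_map"
  unfolding closure_map_def
proof (rule continuous_map_push)
  fix x assume x: "x \<in> topspace \<Delta>"
  show "cl ` {a \<in> P. x a \<noteq> 0} \<in> order_complex P (\<preceq>)"
  proof (rule in_order_complexI)
    show "cl ` {a \<in> P. x a \<noteq> 0} \<subseteq> P" using cl_in by auto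
    show "cl ` {a \<in> P. x a \<noteq> 0} \<noteq> {}" using \<Delta>_ex[OF x] \<Delta>_in[OF x] by auto
    fix p q assume "p \<in> cl ` {a \<in> P. x a \<noteq> 0}" "q \<in> cl ` {a \<in> P. x a \<noteq> 0}"
    then obtain a b where "p = cl a" "q = cl b" "a \<in> P" "b \<in> P" "x a \<noteq> 0" "x b \<noteq> 0"
      by blast
    then show "p \<preceq> q \<or> q \<preceq> p"
      using \<Delta>_chain[OF x, of a b] cl_mono by blast
  qed
qed (simp_all add: finite_P \<Delta>_nonneg \<Delta>_sum continuous_map_coordinate)

text \<open>Suppose \<open>s\<close> lies in \<open>S\<close> but not above \<open>a\<close>, while
  \<open>m\<close> lies above \<open>a\<close> but not in \<open>S\<close>. A support vertex
  \<open>b\<close> below \<open>s\<close> is comparable with \<open>a\<close>, and it must be below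
  \<open>a\<close>, since otherwise \<open>a\<close> would be below \<open>s\<close>. Hence
  \<open>b\<close> is below \<open>m\<close> too and gives it the same share. So \<open>m\<close>
  gets at least the mass of \<open>s\<close>, against the strict inequality for a superlevel
  set.\<close>

lemma level_above_nested:
  assumes x: "x \<in> topspace \<Delta>" and a: "x a \<noteq> 0"
    and S: "S \<in> faces" "level_weight (to_crosscut x) S \<noteq> 0"
  shows "S \<subseteq> above_M a \<or> above_M a \<subseteq> S"
proof (rule ccontr)
  assume "\<not> (S \<subseteq> above_M a \<or> above_M a \<subseteq> S)"
  then obtain s m where sm: "s \<in> S - above_M a" "m \<in> above_M a - S" by blast
  then have M: "s \<in> M" "m \<in> M" "\<not> a \<preceq> s" "a \<preceq> m"
    using S by (auto simp: above_M_def faces_def)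
  \<comment> \<open>The fibre of \<open>snd\<close> over \<open>n\<close> is a copy of
    \<open>P\<close>, so the values at \<open>s\<close> and \<open>m\<close> can be compared term by
    term.\<close>
  have val: "to_crosscut x n = (\<Sum>b\<in>P. if b \<preceq> n then x b / card (above_M b) else 0)"
    if "n \<in> M" for n
  proof -
    have "{i \<in> P \<times> M. snd i = n} = (\<lambda>b. (b, n)) ` P" using that by auto
    then show ?thesis
      by (simp add: to_crosscut_def push_def spread_def sum.reindex inj_on_def)
  qed
  have le: "b \<preceq> m" if "b \<preceq> s" "x b \<noteq> 0" for b
  proof -
    have P: "a \<in> P" "b \<in> P" "s \<in> P" "m \<in> P" using that a \<Delta>_in[OF x] M M_subset by auto
    then have "b \<preceq> a" using \<Delta>_chain[OF x a that(2)] M trans that by blast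
    then show ?thesis using trans P M by blast
  qed
  have "to_crosscut x s \<le> to_crosscut x m"
    unfolding val[OF M(1)] val[OF M(2)]
  proof (rule sum_mono)
    fix b
    show "(if b \<preceq> s then x b / card (above_M b) else 0) \<le>
        (if b \<preceq> m then x b / card (above_M b) else 0)"
      by (cases "x b = 0") (use le[of b] \<Delta>_nonneg[OF x, of b] in auto)
  qed
  moreover have "to_crosscut x m < to_crosscut x s"
    using S sm M level_weight_nonzero_iff by auto
  ultimately show False by simp
qed

text \<open>The supports of the two images consist of meets of superlevel sets of
  \<open>to_crosscut x\<close> and of meets of sets \<open>above_M a\<close>. All these sets
  together are nested, so their meets form one chain, and a linear homotopy works.\<close>

lemma to_order_to_crosscut_homotopic_closure_map:
  "homotopic_with (\<lambda>_. True) \<Delta> \<Delta> (to_order \<circ> to_crosscut) closure_map"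
proof (rule homotopic_with_linear_geometric_realization)
  show "continuous_map \<Delta> \<Delta> (to_order \<circ> to_crosscut)"
    by (rule continuous_map_compose[OF continuous_map_to_crosscut continuous_map_to_order])
  fix x assume x: "x \<in> topspace \<Delta>"
  let ?y = "to_crosscut x"
  have y: "?y \<in> topspace \<Gamma>"
    using continuous_map_image_subset_topspace[OF continuous_map_to_crosscut] x by blast
  define \<S> where "\<S> = {S \<in> faces. level_weight ?y S \<noteq> 0} \<union> above_M ` {a. x a \<noteq> 0}"
  have sub: "\<S> \<subseteq> crosscut_complex"
    using above_in \<Delta>_in[OF x] level_weight_nonzero_in[OF y] by (auto simp: \<S>_def)
  have nested: "S \<subseteq> T \<or> T \<subseteq> S" if "S \<in> \<S>" "T \<in> \<S>" for S T
  proof -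
    have "above_M a \<subseteq> above_M b \<or> above_M b \<subseteq> above_M a" if "x a \<noteq> 0" "x b \<noteq> 0" for a b
      using that \<Delta>_chain[OF x that] above_antimono \<Delta>_in[OF x] by blast
    moreover have "U \<subseteq> above_M a \<or> above_M a \<subseteq> U"
      if "x a \<noteq> 0" "U \<in> faces" "level_weight ?y U \<noteq> 0" for a U
      by (rule level_above_nested[OF x that])
    moreover have "U \<subseteq> V \<or> V \<subseteq> U"
      if "U \<in> faces" "level_weight ?y U \<noteq> 0" "V \<in> faces" "level_weight ?y V \<noteq> 0" for U V
      by (rule level_weight_nonzero_nested[OF that(1,3,2,4)])
    ultimately show ?thesis
      using that unfolding \<S>_def by (elim UnE imageE CollectE conjE) blast+
  qed
  have "meet_M ` \<S> \<in> order_complex P (\<preceq>)"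
  proof (rule in_order_complexI)
    show "meet_M ` \<S> \<subseteq> P" using sub meet_in by blast
    show "meet_M ` \<S> \<noteq> {}" using \<Delta>_ex[OF x] by (auto simp: \<S>_def)
    fix p q assume "p \<in> meet_M ` \<S>" "q \<in> meet_M ` \<S>"
    then obtain S T where "p = meet_M S" "q = meet_M T" "S \<in> \<S>" "T \<in> \<S>" by blast
    then show "p \<preceq> q \<or> q \<preceq> p"
      using meet_nested[OF _ _ nested] sub by blast
  qed
  moreover have "{a. to_order ?y a \<noteq> 0} \<subseteq> meet_M ` \<S>" "{a. closure_map x a \<noteq> 0} \<subseteq> meet_M ` \<S>"
    unfolding support_to_order[OF y] support_closure_map[OF x] \<S>_def by auto
  ultimately show "\<exists>s\<in>order_complex P (\<preceq>). {a. (to_order \<circ> to_crosscut) x a \<noteq> 0} \<subseteq> s \<and>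
      {a. closure_map x a \<noteq> 0} \<subseteq> s"
    by auto
next
  show "finite s" if "s \<in> order_complex P (\<preceq>)" for s
    using that by (simp add: order_complex_def)
qed (fact continuous_map_closure_map order_complex_mono)+

section \<open>Deformation of the identity to the closure map\<close>

text \<open>The schedule of the deformation: it strictly decreases as elements get larger, so larger
  elements have earlier turns.\<close>

definition corank :: "'a \<Rightarrow> nat" where
  "corank a = card {b \<in> P. a \<preceq> b \<and> b \<noteq> a}"

lemma corank_less:
  assumes "a \<in> P" "b \<in> P" "a \<preceq> b" "a \<noteq> b"
  shows "corank b < corank a"
  unfolding corank_def
proof (rule psubset_card_mono)
  show "{c \<in> P. b \<preceq> c \<and> c \<noteq> b} \<subset> {c \<in> P. a \<preceq> c \<and> c \<noteq> a}"
    using assms trans antisym by blast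
qed (simp add: finite_P)

text \<open>The proportion of the mass at \<open>a\<close> that has moved to \<open>cl a\<close> at time \<open>t\<close>.\<close>

definition moved :: "real \<Rightarrow> 'a \<Rightarrow> real" where
  "moved t a = max 0 (min 1 (t * (card P + 1) - corank a))"

lemma moved_bounds: "0 \<le> moved t a" "moved t a \<le> 1"
  by (auto simp: moved_def)

lemma moved_0: "moved 0 a = 0"
  by (simp add: moved_def)

lemma moved_1: "moved 1 a = 1"
proof -
  \<comment> \<open>The factor \<open>card P + 1\<close> in \<open>moved\<close> leaves a full unit
    of rescaled time even for an element of corank \<open>card P\<close>.\<close>
  have "corank a \<le> card P" unfolding corank_def by (rule card_mono) (auto simp: finite_P)
  then show ?thesis by (simp add: moved_def)
qed

text \<open>Coranks are integers, so that of \<open>b\<close> is smaller by at least 1: the unit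
  time slot of \<open>b\<close> is over when that of \<open>a\<close> begins.\<close>

lemma moved_larger_first:
  assumes "a \<in> P" "b \<in> P" "a \<preceq> b" "a \<noteq> b" "moved t a \<noteq> 0"
  shows "moved t b = 1"
  using corank_less[OF assms(1-4)] assms(5) by (auto simp: moved_def max_def min_def split: if_splits)

lemma closure_map_homotopic_id: "homotopic_with (\<lambda>_. True) \<Delta> \<Delta> id closure_map"
proof -
  let ?Z = "prod_topology (top_of_set {0..1::real}) \<Delta>"
  \<comment> \<open>The index \<open>(a, True)\<close> carries the part of the mass of
    \<open>a\<close> already moved to \<open>cl a\<close>, and \<open>(a, False)\<close> the part
    still at \<open>a\<close>.\<close>
  let ?I = "P \<times> (UNIV :: bool set)"
  define v where "v = (\<lambda>(a, c). if c then cl a else a)"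
  define w where "w = (\<lambda>z (a, c). snd z a * (if c then moved (fst z) a else 1 - moved (fst z) a))"
  have "continuous_map ?Z \<Delta> (\<lambda>z. push ?I v (w z))"
  proof (rule continuous_map_push)
    show "finite ?I" using finite_P by simp
    have t: "continuous_map ?Z euclideanreal fst"
      using continuous_map_fst continuous_map_into_fulltopology by blast
    have s: "continuous_map ?Z euclideanreal (\<lambda>z. snd z a)" for a
      using continuous_map_compose[OF continuous_map_snd continuous_map_coordinate]
      by (simp add: o_def)
    have m: "continuous_map ?Z euclideanreal (\<lambda>z. moved (fst z) a)" for a
      unfolding moved_def
      by (intro continuous_map_real_max continuous_map_real_min continuous_map_diff
          continuous_map_real_mult t) auto
    show "continuous_map ?Z euclideanreal (\<lambda>z. w z i)" for i
      by (cases i; cases "snd i")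
        (auto simp: w_def intro!: continuous_map_real_mult continuous_map_diff s m)
    fix z assume "z \<in> topspace ?Z"
    then obtain t x where z: "z = (t, x)" and x: "x \<in> topspace \<Delta>" by (auto simp: topspace_prod_topology)
    show "0 \<le> w z i" for i
      using \<Delta>_nonneg[OF x] moved_bounds by (auto simp: w_def z split: prod.split)
    have "sum (w z) ?I = (\<Sum>a\<in>P. \<Sum>c\<in>UNIV. w z (a, c))"
      by (simp add: sum.cartesian_product)
    also have "\<dots> = (\<Sum>a\<in>P. x a)"
      by (rule sum.cong) (auto simp: w_def z UNIV_bool algebra_simps)
    finally show "sum (w z) ?I = 1" using \<Delta>_sum[OF x] by simp
    \<comment> \<open>If \<open>b\<close> were strictly below \<open>a\<close>, then
      \<open>a\<close> would have moved completely before \<open>b\<close> started. So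
      \<open>a\<close> is below \<open>b\<close>, which is below \<open>cl b\<close>.\<close>
    have comparable: "a \<preceq> cl b \<or> cl b \<preceq> a"
      if "x a \<noteq> 0" "x b \<noteq> 0" "moved t a \<noteq> 1" "moved t b \<noteq> 0" for a b
    proof -
      have P: "a \<in> P" "b \<in> P" using \<Delta>_in[OF x] that by auto
      have "a \<preceq> b"
        using \<Delta>_chain[OF x that(1,2)] moved_larger_first[OF P(2,1)] that P refl by blast
      then show ?thesis using trans[OF P cl_in[OF P(2)]] le_cl P by blast
    qed
    show "v ` {i \<in> ?I. w z i \<noteq> 0} \<in> order_complex P (\<preceq>)"
    proof (rule in_order_complexI)
      show "v ` {i \<in> ?I. w z i \<noteq> 0} \<subseteq> P"
        using cl_in by (auto simp: v_def)
      obtain a where a: "x a \<noteq> 0" using \<Delta>_ex[OF x] by blast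
      then have "w z (a, True) \<noteq> 0 \<or> w z (a, False) \<noteq> 0" by (auto simp: w_def z)
      then show "v ` {i \<in> ?I. w z i \<noteq> 0} \<noteq> {}" using \<Delta>_in[OF x a] by auto
      fix p q assume "p \<in> v ` {i \<in> ?I. w z i \<noteq> 0}" "q \<in> v ` {i \<in> ?I. w z i \<noteq> 0}"
      then obtain a c b d where ab: "p = v (a, c)" "q = v (b, d)" "a \<in> P" "b \<in> P"
        "w z (a, c) \<noteq> 0" "w z (b, d) \<noteq> 0" by auto
      then show "p \<preceq> q \<or> q \<preceq> p"
        using \<Delta>_chain[OF x, of a b] comparable[of a b] comparable[of b a] cl_mono[of a b] cl_mono[of b a]
        by (cases c; cases d) (auto simp: v_def w_def z)
    qed
  qed
  moreover have "push ?I v (w (0, x)) = x" if x: "x \<in> topspace \<Delta>" for x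
  proof
    fix q
    \<comment> \<open>At time 0 only the unmoved part at \<open>q\<close> itself counts. The
      intersection with \<open>?I\<close> covers \<open>q\<close> outside \<open>P\<close>, where
      \<open>x q = 0\<close>.\<close>
    have "push ?I v (w (0, x)) q = (\<Sum>i\<in>{(q, False)} \<inter> ?I. w (0, x) i)"
      unfolding push_def
      by (rule sum.mono_neutral_right)
        (use finite_P in \<open>auto simp: v_def w_def moved_0 split: if_splits\<close>)
    also have "\<dots> = x q"
      using \<Delta>_in[OF x, of q] by (cases "q \<in> P") (auto simp: w_def moved_0)
    finally show "push ?I v (w (0, x)) q = x q" .
  qed
  moreover have "push ?I v (w (1, x)) = closure_map x" for x
  proof
    fix q
    have "push ?I v (w (1, x)) q = (\<Sum>i\<in>(\<lambda>a. (a, True)) ` {a \<in> P. cl a = q}. w (1, x) i)"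
      unfolding push_def
      by (rule sum.mono_neutral_right)
        (use finite_P in \<open>auto simp: v_def w_def moved_1 split: if_splits\<close>)
    also have "\<dots> = closure_map x q"
      by (simp add: sum.reindex inj_on_def w_def moved_1 closure_map_def push_def)
    finally show "push ?I v (w (1, x)) q = closure_map x q" .
  qed
  ultimately show ?thesis
    by (subst homotopic_with) (auto intro!: exI[of _ "\<lambda>z. push ?I v (w z)"])
qed

theorem crosscut_theorem: "\<Delta> homotopy_equivalent_space \<Gamma>"
  unfolding homotopy_equivalent_space_def
proof (intro exI conjI)
  show "homotopic_with (\<lambda>_. True) \<Delta> \<Delta> (to_order \<circ> to_crosscut) id"
    using to_order_to_crosscut_homotopic_closure_map closure_map_homotopic_id
      homotopic_with_trans homotopic_with_sym by blast
qed (fact continuous_map_to_crosscut continuous_map_to_order to_crosscut_to_order_homotopic)+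

end

section \<open>Geometric left regular bands\<close>

text \<open>The meet is the product, starting from \<open>\<one>\<close> for the empty set. If
  \<open>p\<close> is the meet of \<open>S\<close>, then \<open>s \<otimes> p\<close> is fixed by
  each \<open>t\<close> in \<open>S\<close> because \<open>t\<close> can be moved past
  \<open>s\<close>, and by \<open>s\<close> because \<open>s\<close> is idempotent.\<close>

lemma (in left_regular_band_monoid) ex_meet_of_commuting:
  assumes "finite S" "S \<subseteq> carrier B" "\<And>s t. s \<in> S \<Longrightarrow> t \<in> S \<Longrightarrow> s \<otimes> t = t \<otimes> s"
  shows "\<exists>p\<in>carrier B. (\<forall>s\<in>S. R_le B p s) \<and>
    (\<forall>a\<in>carrier B. (\<forall>s\<in>S. R_le B a s) \<longrightarrow> R_le B a p)"
proof -
  have "\<exists>p\<in>carrier B. (\<forall>s\<in>S. s \<otimes> p = p) \<and> (\<forall>a\<in>carrier B. (\<forall>s\<in>S. s \<otimes> a = a) \<longrightarrow> p \<otimes> a = a)"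
    using assms
  proof (induction S)
    case empty
    show ?case by (intro bexI[of _ \<one>]) auto
  next
    case (insert s S)
    then obtain p where p: "p \<in> carrier B" "\<forall>s\<in>S. s \<otimes> p = p"
      "\<forall>a\<in>carrier B. (\<forall>s\<in>S. s \<otimes> a = a) \<longrightarrow> p \<otimes> a = a" by auto
    have "t \<otimes> (s \<otimes> p) = s \<otimes> p" if "t \<in> insert s S" for t
    proof -
      have c: "s \<in> carrier B" "t \<in> carrier B" and st: "t \<otimes> s = s \<otimes> t"
        using insert.prems that by auto
      have "t \<otimes> (s \<otimes> p) = s \<otimes> (t \<otimes> p)"
        using c p(1) st m_assoc by metis
      then show ?thesis
        using that p c idem m_assoc by (metis insert_iff)
    qed
    moreover have "s \<otimes> p \<otimes> a = a" if "a \<in> carrier B" "\<forall>t\<in>insert s S. t \<otimes> a = a" for a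
      using that p insert.prems by (simp add: m_assoc)
    ultimately show ?case using p(1) insert.prems by (intro bexI[of _ "s \<otimes> p"]) auto
  qed
  then show ?thesis unfolding R_le_def .
qed

text \<open>Climb from \<open>a\<close> to a strictly larger nonidentity element until none is left;
  the number of nonidentity elements above drops at each step.\<close>

lemma (in left_regular_band_monoid) below_maximal_nonidentity:
  assumes "finite (carrier B)" "a \<in> carrier B - {\<one>}"
  shows "\<exists>m\<in>maximal_nonidentity B. R_le B a m"
proof -
  let ?U = "\<lambda>b. {c \<in> carrier B - {\<one>}. R_le B b c}"
  show ?thesis using assms(2)
  proof (induction "card (?U a)" arbitrary: a rule: less_induct)
    case less
    show ?case
    proof (cases "a \<in> maximal_nonidentity B")
      case True
      then show ?thesis using R_le_partial_order(1) less.prems by blast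
    next
      case False
      then obtain b where b: "b \<in> carrier B - {\<one>}" "R_le B a b" "b \<noteq> a"
        using less.prems by (auto simp: maximal_nonidentity_def)
      have "?U b \<subset> ?U a"
      proof
        show "?U b \<subseteq> ?U a"
          using b less.prems R_le_partial_order(3)[of a b] by blast
        have "a \<in> ?U a - ?U b"
          using b less.prems R_le_partial_order(1)[of a] R_le_partial_order(2)[of a b] by blast
        then show "?U b \<noteq> ?U a" by blast
      qed
      then have "card (?U b) < card (?U a)"
        using assms(1) by (intro psubset_card_mono) auto
      from less.hyps[OF this b(1)] obtain m where "m \<in> maximal_nonidentity B" "R_le B b m" by blast
      then show ?thesis
        using b less.prems R_le_partial_order(3)[of a b m] by (auto simp: maximal_nonidentity_def)
    qed
  qed
qed

lemma (in left_regular_band_monoid) R_le_one: "s \<in> carrier B \<Longrightarrow> R_le B \<one> s \<Longrightarrow> s = \<one>"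
  by (simp add: R_le_def)

theorem theorem10:
  fixes B :: "('a, 'm) monoid_scheme" (structure)
  assumes "geometric_left_regular_band_monoid B"
    and "finite (carrier B)"
  shows "geometric_realization (order_complex (carrier B - {\<one>}) (R_le B))
    homotopy_equivalent_space
    geometric_realization (clique_complex (commutation_graph B (maximal_nonidentity B)))"
proof -
  interpret geometric_left_regular_band_monoid B by fact
  let ?P = "carrier B - {\<one>}" and ?M = "maximal_nonidentity B"
  have M: "?M \<subseteq> ?P" by (auto simp: maximal_nonidentity_def)
  \<comment> \<open>Commutation, not a lower bound, is the premise here: the claim serves both for
    \<open>ex_meet\<close> and to show that cliques are bounded below in \<open>?P\<close>.\<close>
  have meet: "\<exists>p\<in>?P. (\<forall>s\<in>S. R_le B p s) \<and> (\<forall>b\<in>?P. (\<forall>s\<in>S. R_le B b s) \<longrightarrow> R_le B b p)"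
    if S: "S \<subseteq> ?M" "S \<noteq> {}" and comm: "\<And>s t. s \<in> S \<Longrightarrow> t \<in> S \<Longrightarrow> s \<otimes> t = t \<otimes> s" for S
  proof -
    have sub: "S \<subseteq> carrier B" using S M by blast
    from finite_subset[OF sub assms(2)] sub comm obtain p where p: "p \<in> carrier B" "\<forall>s\<in>S. R_le B p s"
      "\<forall>a\<in>carrier B. (\<forall>s\<in>S. R_le B a s) \<longrightarrow> R_le B a p"
      by (rule ex_meet_of_commuting[THEN bexE]) blast+
    obtain s where "s \<in> S" using S by blast
    \<comment> \<open>The identity is the top element, so it does not lie below the nonidentity
      element \<open>s\<close>.\<close>
    then have "p \<noteq> \<one>" using p(2) R_le_one[of s] S M by blast
    then show ?thesis using p by (intro bexI[of _ p]) auto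
  qed
  \<comment> \<open>Geometricity enters here: the elements of \<open>S\<close> have the common lower
    bound \<open>a\<close>.\<close>
  have comm: "s \<otimes> t = t \<otimes> s"
    if "S \<subseteq> ?M" "a \<in> ?P" "\<And>s. s \<in> S \<Longrightarrow> R_le B a s" "s \<in> S" "t \<in> S" for S a s t
    using that M geometric[of a s t] by blast
  interpret crosscut ?P "R_le B" ?M
  proof
    show "finite ?P" using assms(2) by simp
    show "\<exists>m\<in>?M. R_le B a m" if "a \<in> ?P" for a
      by (rule below_maximal_nonidentity[OF assms(2) that])
    show "\<exists>p\<in>?P. (\<forall>s\<in>S. R_le B p s) \<and> (\<forall>b\<in>?P. (\<forall>s\<in>S. R_le B b s) \<longrightarrow> R_le B b p)"
      if "S \<subseteq> ?M" "S \<noteq> {}" "a \<in> ?P" "\<And>s. s \<in> S \<Longrightarrow> R_le B a s" for S a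
      by (rule meet[OF that(1,2) comm[OF that(1,3,4)]])
  qed (use M R_le_partial_order in blast)+
  have "{s, t} \<in> snd (commutation_graph B ?M) \<longleftrightarrow> s \<otimes> t = t \<otimes> s"
    if "s \<in> ?M" "t \<in> ?M" "s \<noteq> t" for s t
    using that by (auto simp: commutation_graph_def doubleton_eq_iff)
  moreover have "fst (commutation_graph B ?M) = ?M"
    by (simp add: commutation_graph_def)
  \<comment> \<open>The restriction to distinct vertices disappears since every element commutes
    with itself, and finiteness of \<open>S\<close> follows from that of \<open>?M\<close>.\<close>
  ultimately have clique: "S \<in> clique_complex (commutation_graph B ?M) \<longleftrightarrow>
      S \<subseteq> ?M \<and> S \<noteq> {} \<and> (\<forall>s\<in>S. \<forall>t\<in>S. s \<otimes> t = t \<otimes> s)" for S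
    using finite_subset[OF _ finite_M, of S] unfolding clique_complex_def
    by (auto simp: subset_iff) metis
  have cross: "S \<in> crosscut_complex \<longleftrightarrow>
      S \<subseteq> ?M \<and> S \<noteq> {} \<and> (\<forall>s\<in>S. \<forall>t\<in>S. s \<otimes> t = t \<otimes> s)" for S
    using meet[of S] comm[of S] unfolding crosscut_complex_def by blast
  have "clique_complex (commutation_graph B ?M) = crosscut_complex"
    by (rule Set.set_eqI) (simp only: clique cross)
  then show ?thesis using crosscut_theorem by simp
qed

end
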